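(* Let $K$ be any real tensor $K=(K_{j\rho l\sigma})_{1\le j,l\le d;\ \rho,\sigma\in\mathcal{R}}$. For all open, bounded, nonempty $\Omega\subset\mathbb{R}^d$ we have $$\lambda_{\rm atom}(K,\Omega)=\lim_{\varepsilon\to0^+}\lambda_\varepsilon(K,\Omega)=\mu_0 .$$
   Context: $\mathcal{R}\subset\mathbb{Z}^d\setminus\{0\}$ is a finite set with $\operatorname{span}_{\mathbb{Z}}\mathcal{R}=\mathbb{Z}^d$ and $\mathcal{R}=-\mathcal{R}$. $K[A,B]=\sum_{j,l,\rho,\sigma}K_{j\rho l\sigma}A_{j\rho}B_{l\sigma}$ for $A,B\in\mathbb{R}^{d\times\mathcal{R}}$. $D_{\mathcal{R},\varepsilon}y(x)=\big(\frac{y(x+\varepsilon\rho)-y(x)}{\varepsilon}\big)_{\rho\in\mathcal{R}}$. $R_{\rm max}=\max_{\rho\in\mathcal{R}}|\rho|$, $R_0=\max\{R_{\rm max},\sqrt d/4\}$. For $\varepsilon>0$, $\operatorname{sint}_\varepsilon\Omega=\{x\in\Omega\cap\varepsilon\mathbb{Z}^d:\operatorname{dist}(x,\partial\Omega)>\varepsilon R_0\}$, $\operatorname{int}_\varepsilon\Omega=\{x\in\Omega\cap\varepsilon\mathbb{Z}^d:\operatorname{dist}(x,\partial\Omega)>2\varepsilon R_0\}$, and $\mathcal{A}_\varepsilon(\Omega,0)$ is the set of $y\colon\Omega\cap\varepsilon\mathbb{Z}^d\to\mathbb{R}^d$ vanishing on $(\Omega\cap\varepsilon\mathbb{Z}^d)\setminus\operatorname{int}_\varepsilon\Omega$.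 Define $$\lambda_\varepsilon(K,\Omega)=\inf_{y\in\mathcal{A}_\varepsilon(\Omega,0),\,y\ne0}\frac{\varepsilon^d\sum_{x\in\operatorname{sint}_\varepsilon\Omega}K[D_{\mathcal{R},\varepsilon}y(x),D_{\mathcal{R},\varepsilon}y(x)]}{\varepsilon^d\sum_{x\in\operatorname{sint}_\varepsilon\Omega}|D_{\mathcal{R},\varepsilon}y(x)|^2},\qquad\lambda_{\rm atom}(K,\Omega)=\inf_{\varepsilon>0}\lambda_\varepsilon(K,\Omega),$$ with $\inf\emptyset=+\infty$. For $N\in\mathbb{N}$ let $\mathcal{B}_{0,N}$ be the set of $y\colon\{0,\dots,N\}^d\to\mathbb{R}^d$ with $y(z)=0$ whenever $\operatorname{dist}(z,\partial(0,N)^d)\le2R_0$ (extended $[0,N)^d$-periodically to $\mathbb{Z}^d$), and $$\mu_{0,N}=\inf_{y\in\mathcal{B}_{0,N},\,y\ne0}\frac{\sum_{x\in\{0,\dots,N\}^d}K[D_{\mathcal{R},1}y(x),D_{\mathcal{R},1}y(x)]}{\sum_{x\in\{0,\dots,N\}^d}|D_{\mathcal{R},1}y(x)|^2},\qquad\mu_0=\inf_N\mu_{0,N}=\lim_{N\to\infty}\mu_{0,N}$$ ($\mu_{0,N}$ is nonincreasing in $N$ and bounded for large $N$). *)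

theory Defs
  imports "HOL-Analysis.Analysis" "HOL-Library.Real_Mod"
begin

text \<open>
  The integer lattice is kept inside \<open>real ^ 'd\<close> (so \<open>d = CARD('d) \<ge> 1\<close>), which lets one difference
  operator serve both the \<open>\<epsilon>\<close>-scaled and the unscaled lattice.
\<close>

definition int_lattice :: "(real ^ 'd) set" where
  "int_lattice = {x. \<forall>i. x $ i \<in> \<int>}"

definition scaled_lattice :: "real \<Rightarrow> (real ^ 'd) set" where
  "scaled_lattice \<epsilon> = (\<lambda>z. \<epsilon> *\<^sub>R z) ` int_lattice"

abbreviation int_scale :: "int \<Rightarrow> real ^ 'd \<Rightarrow> real ^ 'd" where
  "int_scale k x \<equiv> of_int k *\<^sub>R x"

lemma module_int_scale: "module (int_scale :: int \<Rightarrow> real ^ 'd \<Rightarrow> real ^ 'd)"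
  by unfold_locales (simp_all add: algebra_simps)

definition int_span :: "(real ^ 'd) set \<Rightarrow> (real ^ 'd) set" where
  "int_span = module.span int_scale"

definition interaction_range :: "(real ^ 'd) set \<Rightarrow> bool" where
  "interaction_range R \<longleftrightarrow>
     finite R \<and> R \<subseteq> int_lattice - {0} \<and> int_span R = int_lattice \<and> uminus ` R = R"

definition Rmax :: "(real ^ 'd) set \<Rightarrow> real" where
  "Rmax R = Max (norm ` R)"

definition R0 :: "(real ^ 'd) set \<Rightarrow> real" where
  "R0 R = max (Rmax R) (sqrt (real CARD('d)) / 4)"

text \<open>
  A matrix \<open>A\<close> with rows indexed by coordinates and columns by \<open>R\<close> is represented by its columns:
  the entry with index \<open>(j, \<rho>)\<close> is \<open>A \<rho> $ j\<close>. A tensor is a function \<open>K j \<rho> l \<sigma>\<close>. Only the values at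
  \<open>\<rho>, \<sigma> \<in> R\<close> are ever used.
\<close>

definition tensor_form ::
  "(real ^ 'd) set \<Rightarrow> ('d \<Rightarrow> real ^ 'd \<Rightarrow> 'd \<Rightarrow> real ^ 'd \<Rightarrow> real)
     \<Rightarrow> (real ^ 'd \<Rightarrow> real ^ 'd) \<Rightarrow> (real ^ 'd \<Rightarrow> real ^ 'd) \<Rightarrow> real" where
  "tensor_form R K A B =
     (\<Sum>j\<in>UNIV. \<Sum>l\<in>UNIV. \<Sum>\<rho>\<in>R. \<Sum>\<sigma>\<in>R. K j \<rho> l \<sigma> * A \<rho> $ j * B \<sigma> $ l)"

definition matrix_norm_sq :: "(real ^ 'd) set \<Rightarrow> (real ^ 'd \<Rightarrow> real ^ 'd) \<Rightarrow> real" where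
  "matrix_norm_sq R A = (\<Sum>j\<in>UNIV. \<Sum>\<rho>\<in>R. (A \<rho> $ j)\<^sup>2)"

definition diff_quot ::
  "real \<Rightarrow> (real ^ 'd \<Rightarrow> real ^ 'd) \<Rightarrow> real ^ 'd \<Rightarrow> (real ^ 'd \<Rightarrow> real ^ 'd)" where
  "diff_quot \<epsilon> y x = (\<lambda>\<rho>. (y (x + \<epsilon> *\<^sub>R \<rho>) - y x) /\<^sub>R \<epsilon>)"

definition sint :: "(real ^ 'd) set \<Rightarrow> real \<Rightarrow> (real ^ 'd) set \<Rightarrow> (real ^ 'd) set" where
  "sint R \<epsilon> \<Omega> = {x \<in> \<Omega> \<inter> scaled_lattice \<epsilon>. infdist x (frontier \<Omega>) > \<epsilon> * R0 R}"

definition lint :: "(real ^ 'd) set \<Rightarrow> real \<Rightarrow> (real ^ 'd) set \<Rightarrow> (real ^ 'd) set" where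
  "lint R \<epsilon> \<Omega> = {x \<in> \<Omega> \<inter> scaled_lattice \<epsilon>. infdist x (frontier \<Omega>) > 2 * \<epsilon> * R0 R}"

definition admissible ::
  "(real ^ 'd) set \<Rightarrow> real \<Rightarrow> (real ^ 'd) set \<Rightarrow> (real ^ 'd \<Rightarrow> real ^ 'd) set" where
  "admissible R \<epsilon> \<Omega> =
     {y \<in> \<Omega> \<inter> scaled_lattice \<epsilon> \<rightarrow>\<^sub>E UNIV. \<forall>x \<in> (\<Omega> \<inter> scaled_lattice \<epsilon>) - lint R \<epsilon> \<Omega>. y x = 0}"

text \<open>
  The infima are taken in the extended reals, so that the infimum of the empty set is \<open>\<infinity>\<close>.
  Since functions on a subset are extensional, being nonzero is expressed pointwise on the domain.
  The difference quotients at points of \<open>sint\<close> only use values of \<open>y\<close> on \<open>\<Omega> \<inter> scaled_lattice \<epsilon>\<close>.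
\<close>

definition lambda_eps ::
  "(real ^ 'd) set \<Rightarrow> ('d \<Rightarrow> real ^ 'd \<Rightarrow> 'd \<Rightarrow> real ^ 'd \<Rightarrow> real)
     \<Rightarrow> (real ^ 'd) set \<Rightarrow> real \<Rightarrow> ereal" where
  "lambda_eps R K \<Omega> \<epsilon> =
     (INF y \<in> {y \<in> admissible R \<epsilon> \<Omega>. \<exists>x \<in> \<Omega> \<inter> scaled_lattice \<epsilon>. y x \<noteq> 0}.
        ereal ((\<epsilon> ^ CARD('d) * (\<Sum>x \<in> sint R \<epsilon> \<Omega>. tensor_form R K (diff_quot \<epsilon> y x) (diff_quot \<epsilon> y x)))
             / (\<epsilon> ^ CARD('d) * (\<Sum>x \<in> sint R \<epsilon> \<Omega>. matrix_norm_sq R (diff_quot \<epsilon> y x)))))"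

definition lambda_atom ::
  "(real ^ 'd) set \<Rightarrow> ('d \<Rightarrow> real ^ 'd \<Rightarrow> 'd \<Rightarrow> real ^ 'd \<Rightarrow> real) \<Rightarrow> (real ^ 'd) set \<Rightarrow> ereal" where
  "lambda_atom R K \<Omega> = (INF \<epsilon> \<in> {0<..}. lambda_eps R K \<Omega> \<epsilon>)"

definition grid :: "nat \<Rightarrow> (real ^ 'd) set" where
  "grid N = {z \<in> int_lattice. \<forall>i. 0 \<le> z $ i \<and> z $ i \<le> real N}"

definition open_cube :: "nat \<Rightarrow> (real ^ 'd) set" where
  "open_cube N = box 0 (\<chi> i. real N)"

definition grid_functions :: "(real ^ 'd) set \<Rightarrow> nat \<Rightarrow> (real ^ 'd \<Rightarrow> real ^ 'd) set" where
  "grid_functions R N =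
     {y \<in> grid N \<rightarrow>\<^sub>E UNIV. \<forall>z \<in> grid N. infdist z (frontier (open_cube N)) \<le> 2 * R0 R \<longrightarrow> y z = 0}"

text \<open>
  For \<open>N > 0\<close> and a lattice point \<open>x\<close>, the reduced point lies in \<open>[0,N)\<^sup>d\<close>. Members of
  \<open>grid_functions R N\<close> vanish on all faces of the cube, so the extension also agrees with \<open>y\<close> at the
  grid points having some coordinate \<open>N\<close>.
\<close>

definition periodic_ext :: "nat \<Rightarrow> (real ^ 'd \<Rightarrow> real ^ 'd) \<Rightarrow> (real ^ 'd \<Rightarrow> real ^ 'd)" where
  "periodic_ext N y = (\<lambda>x. y (\<chi> i. x $ i rmod real N))"

definition mu0N ::
  "(real ^ 'd) set \<Rightarrow> ('d \<Rightarrow> real ^ 'd \<Rightarrow> 'd \<Rightarrow> real ^ 'd \<Rightarrow> real) \<Rightarrow> nat \<Rightarrow> ereal" where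
  "mu0N R K N =
     (INF y \<in> {y \<in> grid_functions R N. \<exists>z \<in> grid N. y z \<noteq> 0}.
        ereal ((\<Sum>x \<in> grid N. tensor_form R K (diff_quot 1 (periodic_ext N y) x)
                                            (diff_quot 1 (periodic_ext N y) x))
             / (\<Sum>x \<in> grid N. matrix_norm_sq R (diff_quot 1 (periodic_ext N y) x))))"

definition mu0 ::
  "(real ^ 'd) set \<Rightarrow> ('d \<Rightarrow> real ^ 'd \<Rightarrow> 'd \<Rightarrow> real ^ 'd \<Rightarrow> real) \<Rightarrow> ereal" where
  "mu0 R K = (INF N \<in> {1..}. mu0N R K N)"

end

theory Submission
  imports Defs
begin

text \<open>
  Extension by zero and rescaling turn both kinds of competitors into finitely supported functions
  on the integer lattice without changing the quotient: the boundary layers are so wide that the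
  difference quotients of the extended function vanish outside the sets one sums over, and that
  periodic extension and extension by zero have the same difference quotients. So all quantities
  are infima of one translation invariant quotient over functions with restricted support, and
  every finite support can be translated into a large cube or into a fine discretisation of
  \<open>\<Omega>\<close>.
\<close>

section \<open>Lattice points and quadratic homogeneity of the two forms\<close>

lemma int_lattice_add: "x \<in> int_lattice \<Longrightarrow> y \<in> int_lattice \<Longrightarrow> x + y \<in> int_lattice"
  by (simp add: int_lattice_def)

lemma int_lattice_diff: "x \<in> int_lattice \<Longrightarrow> y \<in> int_lattice \<Longrightarrow> x - y \<in> int_lattice"
  by (simp add: int_lattice_def)

lemma finite_int_lattice_bounded:
  fixes S :: "(real ^ 'd) set"
  assumes "S \<subseteq> int_lattice" and "bounded S"
  shows "finite S"
proof -
  obtain M where M: "\<And>x. x \<in> S \<Longrightarrow> norm x \<le> M"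
    using assms(2) by (auto simp: bounded_iff)
  let ?F = "UNIV \<rightarrow>\<^sub>E {- \<lceil>M\<rceil>..\<lceil>M\<rceil>}"
  have "S \<subseteq> (\<lambda>f. \<chi> i. of_int (f i)) ` ?F"
  proof
    fix x assume x: "x \<in> S"
    have "x = (\<chi> i. of_int \<lfloor>x $ i\<rfloor>)"
      using assms(1) x by (auto simp: int_lattice_def vec_eq_iff Ints_def)
    moreover have "(\<lambda>i. \<lfloor>x $ i\<rfloor>) \<in> ?F"
    proof (rule PiE_I)
      fix i
      have "\<bar>x $ i\<bar> \<le> M"
        using component_le_norm_cart[of x i] M[OF x] by linarith
      then show "\<lfloor>x $ i\<rfloor> \<in> {- \<lceil>M\<rceil>..\<lceil>M\<rceil>}"
        by (auto simp: le_floor_iff) linarith+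
    qed simp
    ultimately show "x \<in> (\<lambda>f. \<chi> i. of_int (f i)) ` ?F"
      by (rule image_eqI)
  qed
  then show ?thesis
    by (rule finite_subset) (intro finite_imageI finite_PiE finite_class.finite_UNIV ballI finite_atLeastAtMost_int)
qed

text \<open>Quadratic homogeneity, with the arguments compared on \<open>R\<close> only. The case
  \<open>c = 0\<close> handles vanishing differences, \<open>c = 1\<close> replaces the periodic
  extension by the extension by zero, and \<open>c = 1 / \<epsilon>\<close> is the
  rescaling.\<close>

lemma tensor_form_scaled_cong:
  assumes "\<And>\<rho>. \<rho> \<in> R \<Longrightarrow> A \<rho> = c *\<^sub>R B \<rho>"
  shows "tensor_form R K A A = c\<^sup>2 * tensor_form R K B B"
  unfolding tensor_form_def sum_distrib_left
  by (intro sum.cong refl) (simp add: assms power2_eq_square)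

lemma matrix_norm_sq_scaled_cong:
  assumes "\<And>\<rho>. \<rho> \<in> R \<Longrightarrow> A \<rho> = c *\<^sub>R B \<rho>"
  shows "matrix_norm_sq R A = c\<^sup>2 * matrix_norm_sq R B"
  unfolding matrix_norm_sq_def sum_distrib_left
  by (intro sum.cong refl) (simp add: assms power_mult_distrib)

lemma tensor_form_zero: "(\<And>\<rho>. \<rho> \<in> R \<Longrightarrow> A \<rho> = 0) \<Longrightarrow> tensor_form R K A A = 0"
  using tensor_form_scaled_cong[of R A 0 A K] by simp

lemma matrix_norm_sq_zero: "(\<And>\<rho>. \<rho> \<in> R \<Longrightarrow> A \<rho> = 0) \<Longrightarrow> matrix_norm_sq R A = 0"
  using matrix_norm_sq_scaled_cong[of R A 0 A] by simp

section \<open>A translation invariant quotient on the integer lattice\<close>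

text \<open>Summing over exactly the lattice points with a nonzero difference along \<open>R\<close>
  frees the quotient below from any reference to a cube, to \<Omega> or to \<epsilon>.\<close>

definition active :: "(real ^ 'd) set \<Rightarrow> (real ^ 'd \<Rightarrow> real ^ 'd) \<Rightarrow> (real ^ 'd) set" where
  "active R u = {x \<in> int_lattice. \<exists>\<rho>\<in>R. u (x + \<rho>) \<noteq> u x}"

definition rayleigh ::
  "(real ^ 'd) set \<Rightarrow> ('d \<Rightarrow> real ^ 'd \<Rightarrow> 'd \<Rightarrow> real ^ 'd \<Rightarrow> real)
     \<Rightarrow> (real ^ 'd \<Rightarrow> real ^ 'd) \<Rightarrow> real" where
  "rayleigh R K u =
     (\<Sum>x\<in>active R u. tensor_form R K (diff_quot 1 u x) (diff_quot 1 u x))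
     / (\<Sum>x\<in>active R u. matrix_norm_sq R (diff_quot 1 u x))"

definition lattice_supp :: "(real ^ 'd \<Rightarrow> real ^ 'd) \<Rightarrow> (real ^ 'd) set" where
  "lattice_supp u = {z \<in> int_lattice. u z \<noteq> 0}"

text \<open>Both summands vanish off \<open>active R u\<close>, so enlarging the index set changes
  neither sum. This is how the sums over the grid and over \<open>sint\<close> become the same
  quotient.\<close>

lemma rayleigh_superset:
  assumes "finite S" and "active R u \<subseteq> S" and "S \<subseteq> int_lattice"
  shows "(\<Sum>x\<in>S. tensor_form R K (diff_quot 1 u x) (diff_quot 1 u x))
           / (\<Sum>x\<in>S. matrix_norm_sq R (diff_quot 1 u x)) = rayleigh R K u"
proof -
  have "diff_quot 1 u x \<rho> = 0" if "x \<in> S - active R u" "\<rho> \<in> R" for x \<rho>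
    using that assms(3) by (auto simp: active_def diff_quot_def)
  then show ?thesis
    unfolding rayleigh_def using assms(1,2)
    by (subst (1 2) sum.mono_neutral_right[of S "active R u"])
       (auto intro!: tensor_form_zero matrix_norm_sq_zero)
qed

text \<open>A lattice shift maps the lattice to itself and commutes with taking differences, so it
  merely moves the active set by \<open>a\<close>.\<close>

lemma rayleigh_translate:
  assumes "a \<in> int_lattice"
  shows "rayleigh R K (\<lambda>z. u (z - a)) = rayleigh R K u"
proof -
  have "active R (\<lambda>z. u (z - a)) = (\<lambda>z. z + a) ` active R u" (is "?L = ?R")
  proof
    show "?R \<subseteq> ?L"
      using assms by (auto simp: active_def int_lattice_add algebra_simps)
    show "?L \<subseteq> ?R"
    proof
      fix x assume "x \<in> ?L"
      then have "x - a \<in> active R u"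
        using assms by (auto simp: active_def int_lattice_diff algebra_simps)
      then show "x \<in> ?R"
        by (rule rev_image_eqI) simp
    qed
  qed
  moreover have "diff_quot 1 (\<lambda>z. u (z - a)) (z + a) = diff_quot 1 u z" for z
    by (simp add: diff_quot_def algebra_simps)
  ultimately show ?thesis
    by (simp add: rayleigh_def sum.reindex)
qed

text \<open>Values off the lattice are left free: for \<open>R\<close> consisting of lattice
  vectors, neither the support nor the quotient sees them.\<close>

definition competitors :: "(real ^ 'd) set \<Rightarrow> (real ^ 'd \<Rightarrow> real ^ 'd) set" where
  "competitors T = {u. lattice_supp u \<noteq> {} \<and> lattice_supp u \<subseteq> T}"

definition rayleigh_inf ::
  "(real ^ 'd) set \<Rightarrow> ('d \<Rightarrow> real ^ 'd \<Rightarrow> 'd \<Rightarrow> real ^ 'd \<Rightarrow> real) \<Rightarrow> (real ^ 'd) set \<Rightarrow> ereal" where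
  "rayleigh_inf R K T = (INF u\<in>competitors T. ereal (rayleigh R K u))"

definition finite_competitors :: "(real ^ 'd \<Rightarrow> real ^ 'd) set" where
  "finite_competitors = {u. lattice_supp u \<noteq> {} \<and> finite (lattice_supp u)}"

text \<open>The common value: \<open>mu0\<close>, \<open>lambda_atom\<close> and the limit of
  \<open>lambda_eps\<close> are each identified with it.\<close>

definition global_inf ::
  "(real ^ 'd) set \<Rightarrow> ('d \<Rightarrow> real ^ 'd \<Rightarrow> 'd \<Rightarrow> real ^ 'd \<Rightarrow> real) \<Rightarrow> ereal" where
  "global_inf R K = (INF u\<in>finite_competitors. ereal (rayleigh R K u))"

text \<open>A bounded set contains only finitely many lattice points, so its competitors form a
  subclass of the finitely supported functions.\<close>

lemma global_inf_le:
  fixes R T :: "(real ^ 'd) set"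
  assumes "bounded T"
  shows "global_inf R K \<le> rayleigh_inf R K T"
proof -
  have "finite (lattice_supp u)" if "lattice_supp u \<subseteq> T" for u :: "real ^ 'd \<Rightarrow> real ^ 'd"
    using assms that bounded_subset
    by (intro finite_int_lattice_bounded) (auto simp: lattice_supp_def)
  then have "competitors T \<subseteq> finite_competitors"
    by (auto simp: competitors_def finite_competitors_def)
  then show ?thesis
    unfolding global_inf_def rayleigh_inf_def by (rule INF_superset_mono) simp
qed

text \<open>By translation invariance it is enough that some lattice translate of the support fits
  into \<open>T\<close>. This is the source of all upper bounds.\<close>

lemma rayleigh_inf_le:
  assumes "lattice_supp u \<noteq> {}" and "a \<in> int_lattice"
    and "\<And>z. z \<in> lattice_supp u \<Longrightarrow> z + a \<in> T"
  shows "rayleigh_inf R K T \<le> ereal (rayleigh R K u)"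
proof -
  have "(\<lambda>z. u (z - a)) \<in> competitors T"
  proof -
    obtain z where "z \<in> lattice_supp u" using assms(1) by blast
    then have "z + a \<in> lattice_supp (\<lambda>z. u (z - a))"
      using assms(2) by (simp add: lattice_supp_def int_lattice_add)
    moreover have "z \<in> T" if "z \<in> lattice_supp (\<lambda>z. u (z - a))" for z
      using assms(3)[of "z - a"] that assms(2) by (simp add: lattice_supp_def int_lattice_diff)
    ultimately show ?thesis by (auto simp: competitors_def)
  qed
  then show ?thesis
    unfolding rayleigh_inf_def using rayleigh_translate[OF assms(2)]
    by (metis INF_lower)
qed

text \<open>A nonzero difference forces \<open>u\<close> to be nonzero at one of its two end points;
  \<open>insert 0 R\<close> treats the end points \<open>x + \<rho>\<close> and \<open>x\<close>
  uniformly.\<close>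

lemma active_subset:
  assumes "R \<subseteq> int_lattice" and "lattice_supp u \<subseteq> T"
    and "\<And>x \<rho>. x \<in> int_lattice \<Longrightarrow> \<rho> \<in> insert 0 R \<Longrightarrow> x + \<rho> \<in> T \<Longrightarrow> x \<in> S"
  shows "active R u \<subseteq> S"
proof
  fix x assume "x \<in> active R u"
  then obtain \<rho> where x: "x \<in> int_lattice" and \<rho>: "\<rho> \<in> R" "u (x + \<rho>) \<noteq> u x"
    by (auto simp: active_def)
  then have "u (x + \<rho>) \<noteq> 0 \<or> u (x + 0) \<noteq> 0" by auto
  then have "x + \<rho> \<in> T \<or> x + 0 \<in> T"
    using x \<rho>(1) assms(1,2) by (auto simp: lattice_supp_def int_lattice_add subset_iff)
  then show "x \<in> S"
    using assms(3)[OF x] \<rho>(1) by blast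
qed

section \<open>Bounds on the interaction range and the periodic problem on a cube\<close>

context
  fixes R :: "(real ^ 'd) set"
  assumes R: "interaction_range R"
begin

lemma range_lattice: "R \<subseteq> int_lattice"
  using R by (auto simp: interaction_range_def)

lemma R0_pos: "0 < R0 R"
  by (simp add: R0_def less_max_iff_disj)

lemma norm_range_le:
  assumes "\<rho> \<in> insert 0 R"
  shows "norm \<rho> \<le> R0 R"
proof (cases "\<rho> \<in> R")
  case True
  then have "norm \<rho> \<le> Rmax R"
    using R by (simp add: Rmax_def interaction_range_def)
  then show ?thesis by (simp add: R0_def)
next
  case False
  then show ?thesis using assms R0_pos by simp
qed

lemma component_range_le: "\<rho> \<in> insert 0 R \<Longrightarrow> \<bar>\<rho> $ i\<bar> \<le> R0 R"
  using component_le_norm_cart norm_range_le order_trans by blast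

definition deep_cube :: "nat \<Rightarrow> (real ^ 'd) set" where
  "deep_cube N = {z. \<forall>i. 2 * R0 R < z $ i \<and> z $ i < real N - 2 * R0 R}"

text \<open>For a point of the closed cube, the distance to the boundary is the smallest distance to
  a face, which can be read off coordinate by coordinate.\<close>

lemma infdist_frontier_cube:
  assumes "N \<ge> 1" and z: "z \<in> grid N"
  shows "2 * R0 R < infdist z (frontier (open_cube N)) \<longleftrightarrow> z \<in> deep_cube N"
proof -
  have ne: "(\<chi> i. real N / 2) \<in> (open_cube N :: (real ^ 'd) set)"
    using assms(1) by (simp add: open_cube_def mem_box_cart)
  have fr: "frontier (open_cube N :: (real ^ 'd) set) =
      {x. (\<forall>i. 0 \<le> x $ i \<and> x $ i \<le> real N) \<and> (\<exists>i. x $ i = 0 \<or> x $ i = real N)}"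
  proof -
    have "frontier (open_cube N :: (real ^ 'd) set) = cbox 0 (\<chi> i. real N) - box 0 (\<chi> i. real N)"
      using ne unfolding open_cube_def by (subst frontier_box) auto
    moreover have "x \<in> cbox 0 (\<chi> i. real N) - box 0 (\<chi> i. real N) \<longleftrightarrow>
        (\<forall>i. 0 \<le> x $ i \<and> x $ i \<le> real N) \<and> (\<exists>i. x $ i = 0 \<or> x $ i = real N)" for x :: "real ^ 'd"
    proof -
      have "(0 < x $ i \<and> x $ i < real N) \<longleftrightarrow>
          (0 \<le> x $ i \<and> x $ i \<le> real N) \<and> \<not> (x $ i = 0 \<or> x $ i = real N)" for i
        by linarith
      then show ?thesis by (simp add: mem_box_cart) blast
    qed
    ultimately show ?thesis by blast
  qed
  have grid: "0 \<le> z $ i \<and> z $ i \<le> real N" for i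
    using z by (simp add: grid_def)
  show ?thesis
  proof
    assume far: "2 * R0 R < infdist z (frontier (open_cube N))"
    have *: "2 * R0 R < \<bar>z $ i - c\<bar>" if c: "c = 0 \<or> c = real N" for i c
    proof -
      \<comment> \<open>The orthogonal projection of \<open>z\<close> onto the face where coordinate
        \<open>i\<close> equals \<open>c\<close>; the other coordinates stay in range, so it is a
        boundary point.\<close>
      let ?p = "\<chi> j. if j = i then c else z $ j"
      have "?p \<in> frontier (open_cube N)"
        using c grid unfolding fr by (auto intro: exI[of _ i])
      then have "infdist z (frontier (open_cube N)) \<le> dist z ?p"
        by (rule infdist_le)
      also have "dist z ?p = \<bar>z $ i - c\<bar>"
      proof -
        have "z - ?p = (z $ i - c) *\<^sub>R axis i 1"
          by (simp add: vec_eq_iff axis_def)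
        then show ?thesis by (simp add: dist_norm norm_axis_1)
      qed
      finally show ?thesis using far by simp
    qed
    show "z \<in> deep_cube N"
      unfolding deep_cube_def
    proof (intro CollectI allI)
      fix i
      show "2 * R0 R < z $ i \<and> z $ i < real N - 2 * R0 R"
        using *[of 0 i] *[of "real N" i] grid[of i] by simp
    qed
  next
    assume deep: "z \<in> deep_cube N"
    \<comment> \<open>The distance to the nearest face. As a minimum over finitely many coordinates
      it still exceeds \<open>2 * R0 R\<close> strictly, whereas bounding the infimum over the
      frontier directly would only give a weak inequality.\<close>
    define m where "m = Min (range (\<lambda>i. min (z $ i) (real N - z $ i)))"
    have "m \<in> range (\<lambda>i. min (z $ i) (real N - z $ i))"
      unfolding m_def by (rule Min_in) auto
    then have "2 * R0 R < m"
      using deep by (auto simp: deep_cube_def algebra_simps)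
    also have "m \<le> infdist z (frontier (open_cube N))"
      unfolding infdist_def
    proof (subst if_not_P)
      show ne': "frontier (open_cube N :: (real ^ 'd) set) \<noteq> {}"
        by (auto simp: fr intro!: exI[of _ 0])
      show "m \<le> (INF a\<in>frontier (open_cube N). dist z a)"
      proof (rule cINF_greatest[OF ne'])
        fix p :: "real ^ 'd" assume "p \<in> frontier (open_cube N)"
        then obtain i where i: "p $ i = 0 \<or> p $ i = real N" by (auto simp: fr)
        have "m \<le> min (z $ i) (real N - z $ i)"
          unfolding m_def by (rule Min_le) auto
        also have "\<dots> \<le> \<bar>(z - p) $ i\<bar>"
          using i by auto
        also have "\<dots> \<le> dist z p"
          unfolding dist_norm by (rule component_le_norm_cart)
        finally show "m \<le> dist z p" .
      qed
    qed
    finally show "2 * R0 R < infdist z (frontier (open_cube N))" .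
  qed
qed

lemma grid_functions_iff:
  assumes "N \<ge> 1"
  shows "y \<in> grid_functions R N \<longleftrightarrow>
    y \<in> grid N \<rightarrow>\<^sub>E UNIV \<and> (\<forall>z \<in> grid N. y z \<noteq> 0 \<longrightarrow> z \<in> deep_cube N)"
  unfolding grid_functions_def using infdist_frontier_cube[OF assms] by (auto simp: not_less[symmetric])

lemma deep_cube_grid:
  assumes "z \<in> int_lattice" and "z \<in> deep_cube N"
  shows "z \<in> grid N"
proof -
  have "0 \<le> z $ i \<and> z $ i \<le> real N" for i
    using assms(2) R0_pos unfolding deep_cube_def by (auto dest!: spec[of _ i])
  then show ?thesis using assms(1) by (simp add: grid_def)
qed

text \<open>One step changes a coordinate by at most \<open>R0 R\<close>, less than the margin
  \<open>2 * R0 R\<close>.\<close>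

lemma near_deep_cube_grid:
  assumes "x \<in> int_lattice" and "\<rho> \<in> insert 0 R" and "x + \<rho> \<in> deep_cube N"
  shows "x \<in> grid N"
proof -
  have "0 \<le> x $ i \<and> x $ i \<le> real N" for i
    using assms(3) R0_pos component_range_le[OF assms(2), of i]
    unfolding deep_cube_def by (auto dest!: spec[of _ i])
  then show ?thesis using assms(1) by (simp add: grid_def)
qed

text \<open>A step from the grid leaves the cube by at most \<open>R0 R\<close>. If reduction modulo
  \<open>N\<close> moves the point at all, it lands in the boundary layer where \<open>y\<close>
  vanishes, and \<open>u\<close> vanishes at the unreduced point.\<close>

lemma periodic_ext_near_grid:
  assumes "N \<ge> 1" and y: "y \<in> grid_functions R N"
    and u: "\<And>z. z \<in> grid N \<Longrightarrow> u z = y z" "lattice_supp u \<subseteq> deep_cube N"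
    and x: "x \<in> grid N" and \<rho>: "\<rho> \<in> insert 0 R"
  shows "periodic_ext N y (x + \<rho>) = u (x + \<rho>)"
proof -
  let ?w = "x + \<rho>"
  define p :: "real ^ 'd" where "p = (\<chi> i. ?w $ i rmod real N)"
  have N: "real N > 0" using assms(1) by simp
  have w: "?w \<in> int_lattice"
    using x \<rho> range_lattice by (auto simp: grid_def int_lattice_add)
  have p_eq: "p $ i = ?w $ i - real N * of_int \<lfloor>?w $ i / real N\<rfloor>" for i
    using N by (simp add: p_def rmod_def)
  have p_bounds: "0 \<le> p $ i \<and> p $ i < real N" for i
    using N rmod_less[of "real N" "?w $ i"] rmod_nonneg[of "real N" "?w $ i"] by (simp add: p_def)
  have "p $ i \<in> \<int>" for i
    unfolding p_eq using w by (auto simp: int_lattice_def intro!: Ints_diff Ints_mult)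
  then have pg: "p \<in> grid N"
    using p_bounds by (auto simp: grid_def int_lattice_def less_imp_le)
  have per: "periodic_ext N y ?w = y p"
    by (simp add: periodic_ext_def p_def)
  show ?thesis
  proof (cases "p = ?w")
    case True
    then show ?thesis using per u(1)[OF pg] by simp
  next
    case False
    have "y p = 0"
    proof (rule ccontr)
      assume "y p \<noteq> 0"
      then have deep: "p \<in> deep_cube N"
        using y pg grid_functions_iff[OF assms(1)] by blast
      have "p $ i = ?w $ i" for i
      proof -
        let ?k = "\<lfloor>?w $ i / real N\<rfloor>"
        have d: "2 * R0 R < p $ i" "p $ i < real N - 2 * R0 R"
          using deep by (auto simp: deep_cube_def)
        have xi: "0 \<le> x $ i" "x $ i \<le> real N" using x by (auto simp: grid_def)
        have c: "\<bar>\<rho> $ i\<bar> \<le> R0 R" using \<rho> by (rule component_range_le)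
        have e: "x $ i + \<rho> $ i = p $ i + real N * of_int ?k"
          using p_eq[of i] by simp
        \<comment> \<open>Wrapping upwards would put the coordinate of \<open>?w\<close> above
          \<open>N + 2 * R0 R\<close>, but it is at most \<open>N + R0 R\<close>. Symmetrically, a
          negative \<open>?k\<close> would put it below \<open>- 2 * R0 R\<close>.\<close>
        have "\<not> ?k \<ge> 1"
        proof
          assume "?k \<ge> 1"
          then have "1 \<le> real_of_int ?k" by linarith
          then have "real N * 1 \<le> real N * of_int ?k"
            using N by (intro mult_left_mono) auto
          then show False using e d xi c R0_pos by linarith
        qed
        moreover have "\<not> ?k \<le> -1"
        proof
          assume "?k \<le> -1"
          then have "real_of_int ?k \<le> -1" by linarith
          then have "real N * of_int ?k \<le> real N * (-1)"
            using N by (intro mult_left_mono) auto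
          then show False using e d xi c R0_pos by linarith
        qed
        ultimately have "?k = 0" by linarith
        then show ?thesis using p_eq[of i] by simp
      qed
      then show False using False by (simp add: vec_eq_iff)
    qed
    moreover have "u ?w = 0"
    proof (rule ccontr)
      assume "u ?w \<noteq> 0"
      then have "?w \<in> deep_cube N" using u(2) w by (auto simp: lattice_supp_def)
      \<comment> \<open>A point with all coordinates in the half-open range is its own
        representative, contradicting \<open>p \<noteq> ?w\<close>.\<close>
      then have b: "0 \<le> ?w $ i \<and> ?w $ i < real N" for i
        using R0_pos unfolding deep_cube_def by (auto dest!: spec[of _ i])
      have "\<lfloor>?w $ i / real N\<rfloor> = 0" for i
        using b[of i] N by (simp add: floor_eq_iff)
      then have "p = ?w" using p_eq by (simp add: vec_eq_iff)
      then show False using False by simp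
    qed
    ultimately show ?thesis using per by simp
  qed
qed

lemma finite_grid: "finite (grid N :: (real ^ 'd) set)"
proof (rule finite_int_lattice_bounded)
  show "(grid N :: (real ^ 'd) set) \<subseteq> int_lattice" by (auto simp: grid_def)
  have "grid N \<subseteq> cbox (0 :: real ^ 'd) (\<chi> i. real N)"
    by (auto simp: grid_def mem_box_cart)
  then show "bounded (grid N :: (real ^ 'd) set)"
    using bounded_cbox bounded_subset by blast
qed

text \<open>The grid contains opposite faces that periodicity identifies, but this double counting
  adds nothing: from a face, one step cannot reach the deep cube, so all differences there are
  zero.\<close>

lemma grid_quotient_eq_rayleigh:
  assumes "N \<ge> 1" and "y \<in> grid_functions R N"
    and "\<And>z. z \<in> grid N \<Longrightarrow> u z = y z" and "lattice_supp u \<subseteq> deep_cube N"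
  shows "(\<Sum>x \<in> grid N. tensor_form R K (diff_quot 1 (periodic_ext N y) x)
                                         (diff_quot 1 (periodic_ext N y) x))
           / (\<Sum>x \<in> grid N. matrix_norm_sq R (diff_quot 1 (periodic_ext N y) x)) = rayleigh R K u"
proof -
  have "diff_quot 1 (periodic_ext N y) x \<rho> = 1 *\<^sub>R diff_quot 1 u x \<rho>"
    if "x \<in> grid N" "\<rho> \<in> R" for x \<rho>
    using periodic_ext_near_grid[OF assms that(1), of \<rho>]
      periodic_ext_near_grid[OF assms that(1), of 0] that(2)
    by (simp add: diff_quot_def)
  note * = tensor_form_scaled_cong[OF this] matrix_norm_sq_scaled_cong[OF this]
  have "active R u \<subseteq> grid N"
    using range_lattice assms(4) near_deep_cube_grid by (rule active_subset)
  then have "(\<Sum>x\<in>grid N. tensor_form R K (diff_quot 1 u x) (diff_quot 1 u x))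
        / (\<Sum>x\<in>grid N. matrix_norm_sq R (diff_quot 1 u x)) = rayleigh R K u"
    by (intro rayleigh_superset finite_grid) (auto simp: grid_def)
  then show ?thesis using * by simp
qed

lemma mu0N_eq_rayleigh_inf:
  assumes "N \<ge> 1"
  shows "mu0N R K N = rayleigh_inf R K (deep_cube N)"
  unfolding mu0N_def rayleigh_inf_def
proof (rule INF_eq)
  fix y assume "y \<in> {y \<in> grid_functions R N. \<exists>z \<in> grid N. y z \<noteq> 0}"
  then obtain z where y: "y \<in> grid_functions R N" and z: "z \<in> grid N" "y z \<noteq> 0" by auto
  \<comment> \<open>The cut-off is essential, since \<open>y\<close> is \<open>undefined\<close>
    rather than zero off the grid.\<close>
  define u where "u z = (if z \<in> grid N then y z else 0)" for z
  have "lattice_supp u \<subseteq> deep_cube N"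
    using y by (auto simp: lattice_supp_def u_def grid_functions_iff[OF assms] split: if_splits)
  moreover have "z \<in> lattice_supp u"
    using z by (simp add: lattice_supp_def u_def grid_def)
  ultimately show "\<exists>u\<in>competitors (deep_cube N). ereal (rayleigh R K u) \<le>
     ereal ((\<Sum>x \<in> grid N. tensor_form R K (diff_quot 1 (periodic_ext N y) x)
                                            (diff_quot 1 (periodic_ext N y) x))
             / (\<Sum>x \<in> grid N. matrix_norm_sq R (diff_quot 1 (periodic_ext N y) x)))"
    using grid_quotient_eq_rayleigh[OF assms y, of u K]
    by (intro bexI[of _ u]) (auto simp: competitors_def u_def)
next
  fix u :: "real ^ 'd \<Rightarrow> real ^ 'd" assume u: "u \<in> competitors (deep_cube N)"
  define y where "y = restrict u (grid N)"
  have supp: "lattice_supp u \<subseteq> deep_cube N" using u by (simp add: competitors_def)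
  then have y: "y \<in> grid_functions R N"
    unfolding grid_functions_iff[OF assms] by (auto simp: y_def lattice_supp_def grid_def)
  obtain z where "z \<in> lattice_supp u" using u by (auto simp: competitors_def)
  then have "z \<in> grid N" "y z \<noteq> 0"
    using supp deep_cube_grid[of z N] by (auto simp: lattice_supp_def y_def)
  then show "\<exists>y\<in>{y \<in> grid_functions R N. \<exists>z \<in> grid N. y z \<noteq> 0}.
     ereal ((\<Sum>x \<in> grid N. tensor_form R K (diff_quot 1 (periodic_ext N y) x)
                                            (diff_quot 1 (periodic_ext N y) x))
             / (\<Sum>x \<in> grid N. matrix_norm_sq R (diff_quot 1 (periodic_ext N y) x)))
       \<le> ereal (rayleigh R K u)"
    using grid_quotient_eq_rayleigh[OF assms y _ supp, of K] y
    by (intro bexI[of _ y]) (auto simp: y_def)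
qed

lemma mu0_eq_global_inf: "mu0 R K = global_inf R K"
proof (rule antisym)
  have "bounded (deep_cube N)" for N
  proof -
    have "deep_cube N \<subseteq> cbox (\<chi> i. 2 * R0 R) (\<chi> i. real N - 2 * R0 R)"
      by (auto simp: deep_cube_def mem_box_cart less_imp_le)
    then show ?thesis using bounded_cbox bounded_subset by blast
  qed
  then show "global_inf R K \<le> mu0 R K"
    unfolding mu0_def by (intro INF_greatest) (simp add: mu0N_eq_rayleigh_inf global_inf_le)
  show "mu0 R K \<le> global_inf R K"
    unfolding global_inf_def
  proof (rule INF_greatest)
    fix u :: "real ^ 'd \<Rightarrow> real ^ 'd" assume "u \<in> finite_competitors"
    then have u: "lattice_supp u \<noteq> {}" "bounded (lattice_supp u)"
      by (auto simp: finite_competitors_def finite_imp_bounded)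
    then obtain M where M: "\<And>z. z \<in> lattice_supp u \<Longrightarrow> norm z \<le> M"
      by (auto simp: bounded_iff)
    \<comment> \<open>Half the side length: shifting by \<open>(n, ..., n)\<close> centres the
      support in the cube of side \<open>2 * n\<close>, with coordinates between
      \<open>n - M\<close> and \<open>n + M\<close>, hence at distance more than
      \<open>2 * R0 R\<close> from every face.\<close>
    obtain n :: nat where n: "M + 2 * R0 R < real n" using reals_Archimedean2 by blast
    have Mi: "\<bar>z $ i\<bar> \<le> M" if "z \<in> lattice_supp u" for z i
      using component_le_norm_cart[of z i] M[OF that] by linarith
    have n1: "2 * n \<ge> 1"
    proof -
      obtain z where "z \<in> lattice_supp u" using u(1) by blast
      then have "0 < real n" using M[of z] norm_ge_zero[of z] n R0_pos by linarith
      then show ?thesis by simp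
    qed
    have "mu0 R K \<le> mu0N R K (2 * n)"
      unfolding mu0_def using n1 by (intro INF_lower) simp
    also have "\<dots> = rayleigh_inf R K (deep_cube (2 * n))"
      using n1 by (rule mu0N_eq_rayleigh_inf)
    also have "\<dots> \<le> ereal (rayleigh R K u)"
    proof (rule rayleigh_inf_le[OF u(1)])
      show "(\<chi> i. real n) \<in> int_lattice" by (simp add: int_lattice_def)
      show "z + (\<chi> i. real n) \<in> deep_cube (2 * n)" if "z \<in> lattice_supp u" for z
        unfolding deep_cube_def
      proof (intro CollectI allI)
        fix i
        show "2 * R0 R < (z + (\<chi> i. real n)) $ i \<and> (z + (\<chi> i. real n)) $ i < real (2 * n) - 2 * R0 R"
          using Mi[OF that, of i] n by (simp add: abs_le_iff)
      qed
    qed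
    finally show "mu0 R K \<le> ereal (rayleigh R K u)" .
  qed
qed

section \<open>The problem on \<Omega> at a fixed scale\<close>

context
  fixes \<Omega> :: "(real ^ 'd) set" and \<epsilon> :: real
  assumes \<Omega>: "open \<Omega>" "bounded \<Omega>" and \<epsilon>: "\<epsilon> > 0"
begin

lemma scaled_lattice_iff: "\<epsilon> *\<^sub>R z \<in> scaled_lattice \<epsilon> \<longleftrightarrow> z \<in> int_lattice"
  using \<epsilon> by (auto simp: scaled_lattice_def)

lemma mem_scaled_lattice_obtain:
  assumes "x \<in> scaled_lattice \<epsilon>"
  obtains z where "z \<in> int_lattice" "x = \<epsilon> *\<^sub>R z"
  using assms by (auto simp: scaled_lattice_def)

definition scaled_lint :: "(real ^ 'd) set" where
  "scaled_lint = {z. \<epsilon> *\<^sub>R z \<in> lint R \<epsilon> \<Omega>}"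

definition scaled_sint :: "(real ^ 'd) set" where
  "scaled_sint = {z. \<epsilon> *\<^sub>R z \<in> sint R \<epsilon> \<Omega>}"

text \<open>A segment that starts in \<Omega> and ends outside meets the frontier, at distance at
  most \<open>norm v\<close> from \<open>x\<close>.\<close>

lemma mem_open_of_infdist:
  assumes "x \<in> \<Omega>" and "norm v < infdist x (frontier \<Omega>)"
  shows "x + v \<in> \<Omega>"
proof (rule ccontr)
  assume "x + v \<notin> \<Omega>"
  then have "closed_segment x (x + v) \<inter> frontier \<Omega> \<noteq> {}"
    using assms(1) by (intro connected_Int_frontier connected_segment) auto
  then obtain p where p: "p \<in> closed_segment x (x + v)" "p \<in> frontier \<Omega>" by auto
  have "infdist x (frontier \<Omega>) \<le> dist x p" using p(2) by (rule infdist_le)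
  also have "\<dots> \<le> norm v"
    using segment_bound(1)[OF p(1)] by (simp add: dist_norm norm_minus_commute)
  finally show False using assms(2) by simp
qed

lemma norm_scaled_range_le: "\<rho> \<in> insert 0 R \<Longrightarrow> norm (\<epsilon> *\<^sub>R \<rho>) \<le> \<epsilon> * R0 R"
  using norm_range_le[of \<rho>] \<epsilon> by (simp del: insert_iff)

text \<open>One scaled step has length at most \<open>\<epsilon> * R0 R\<close>, so of the margin
  \<open>2 * \<epsilon> * R0 R\<close> more than \<open>\<epsilon> * R0 R\<close> remains.\<close>

lemma near_lint_sint:
  assumes "x \<in> int_lattice" and \<rho>: "\<rho> \<in> insert 0 R" and "x + \<rho> \<in> scaled_lint"
  shows "x \<in> scaled_sint"
proof -
  let ?p = "\<epsilon> *\<^sub>R x + \<epsilon> *\<^sub>R \<rho>"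
  have p: "?p \<in> \<Omega>" "2 * \<epsilon> * R0 R < infdist ?p (frontier \<Omega>)"
    using assms(3) by (auto simp: scaled_lint_def lint_def scaleR_right_distrib)
  have n: "norm (\<epsilon> *\<^sub>R \<rho>) \<le> \<epsilon> * R0 R" using \<rho> by (rule norm_scaled_range_le)
  have pos: "0 < \<epsilon> * R0 R" using \<epsilon> R0_pos by simp
  have "?p + (- (\<epsilon> *\<^sub>R \<rho>)) \<in> \<Omega>"
    using p(1) by (rule mem_open_of_infdist) (use p(2) n pos in simp)
  moreover have "infdist ?p (frontier \<Omega>) \<le> infdist (\<epsilon> *\<^sub>R x) (frontier \<Omega>) + norm (\<epsilon> *\<^sub>R \<rho>)"
    using infdist_triangle[of ?p "frontier \<Omega>" "\<epsilon> *\<^sub>R x"] by (simp add: dist_norm)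
  ultimately show ?thesis
    using p(2) n assms(1) by (simp add: scaled_sint_def sint_def scaled_lattice_iff)
qed

lemma bounded_scaled_lint: "bounded scaled_lint"
proof (rule bounded_subset)
  show "bounded ((\<lambda>x. (1 / \<epsilon>) *\<^sub>R x) ` \<Omega>)" using \<Omega>(2) by (rule bounded_scaling)
  show "scaled_lint \<subseteq> (\<lambda>x. (1 / \<epsilon>) *\<^sub>R x) ` \<Omega>"
    using \<epsilon> by (auto simp: scaled_lint_def lint_def intro!: rev_image_eqI)
qed

lemma finite_scaled_sint: "finite scaled_sint"
proof (rule finite_int_lattice_bounded)
  show "scaled_sint \<subseteq> int_lattice"
    by (auto simp: scaled_sint_def sint_def scaled_lattice_iff)
  show "bounded scaled_sint"
  proof (rule bounded_subset)
    show "bounded ((\<lambda>x. (1 / \<epsilon>) *\<^sub>R x) ` \<Omega>)" using \<Omega>(2) by (rule bounded_scaling)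
    show "scaled_sint \<subseteq> (\<lambda>x. (1 / \<epsilon>) *\<^sub>R x) ` \<Omega>"
      using \<epsilon> by (auto simp: scaled_sint_def sint_def intro!: rev_image_eqI)
  qed
qed

lemma sint_eq_image: "sint R \<epsilon> \<Omega> = (\<lambda>z. \<epsilon> *\<^sub>R z) ` scaled_sint"
  by (auto simp: scaled_sint_def sint_def scaled_lattice_def)

lemma admissible_iff:
  "y \<in> admissible R \<epsilon> \<Omega> \<longleftrightarrow> y \<in> \<Omega> \<inter> scaled_lattice \<epsilon> \<rightarrow>\<^sub>E UNIV \<and>
     (\<forall>x \<in> \<Omega> \<inter> scaled_lattice \<epsilon>. y x \<noteq> 0 \<longrightarrow> x \<in> lint R \<epsilon> \<Omega>)"
  by (auto simp: admissible_def)

lemma lambda_quotient_eq_rayleigh: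
  assumes u: "\<And>z. z \<in> int_lattice \<Longrightarrow> \<epsilon> *\<^sub>R z \<in> \<Omega> \<Longrightarrow> u z = y (\<epsilon> *\<^sub>R z)"
    and supp: "lattice_supp u \<subseteq> scaled_lint"
  shows "(\<epsilon> ^ CARD('d) * (\<Sum>x \<in> sint R \<epsilon> \<Omega>. tensor_form R K (diff_quot \<epsilon> y x) (diff_quot \<epsilon> y x)))
           / (\<epsilon> ^ CARD('d) * (\<Sum>x \<in> sint R \<epsilon> \<Omega>. matrix_norm_sq R (diff_quot \<epsilon> y x)))
         = rayleigh R K u"
proof -
  \<comment> \<open>From \<open>sint\<close>, a scaled step stays inside \<Omega>, so
    \<open>y\<close> is evaluated only on its domain; \<open>\<rho> = 0\<close> covers the base
    point of the difference.\<close>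
  have val: "y (\<epsilon> *\<^sub>R z + \<epsilon> *\<^sub>R \<rho>) = u (z + \<rho>)" if z: "z \<in> scaled_sint" and \<rho>: "\<rho> \<in> insert 0 R" for z \<rho>
  proof -
    have "\<epsilon> *\<^sub>R z + \<epsilon> *\<^sub>R \<rho> \<in> \<Omega>"
      using z norm_scaled_range_le[OF \<rho>]
      by (intro mem_open_of_infdist) (auto simp: scaled_sint_def sint_def)
    moreover have "z + \<rho> \<in> int_lattice"
      using z \<rho> range_lattice
      by (auto simp: scaled_sint_def sint_def scaled_lattice_iff int_lattice_add)
    ultimately show ?thesis using u[of "z + \<rho>"] by (simp add: scaleR_right_distrib)
  qed
  have "diff_quot \<epsilon> y (\<epsilon> *\<^sub>R z) \<rho> = (1 / \<epsilon>) *\<^sub>R diff_quot 1 u z \<rho>"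
    if "z \<in> scaled_sint" "\<rho> \<in> R" for z \<rho>
    using val[OF that(1), of \<rho>] val[OF that(1), of 0] that(2)
    by (simp add: diff_quot_def inverse_eq_divide)
  note * = tensor_form_scaled_cong[OF this] matrix_norm_sq_scaled_cong[OF this]
  have inj: "inj_on (\<lambda>z. \<epsilon> *\<^sub>R z) scaled_sint" using \<epsilon> by (auto simp: inj_on_def)
  have "active R u \<subseteq> scaled_sint"
    using range_lattice supp near_lint_sint by (rule active_subset)
  then have "(\<Sum>x\<in>scaled_sint. tensor_form R K (diff_quot 1 u x) (diff_quot 1 u x))
        / (\<Sum>x\<in>scaled_sint. matrix_norm_sq R (diff_quot 1 u x)) = rayleigh R K u"
    by (intro rayleigh_superset finite_scaled_sint)
       (auto simp: scaled_sint_def sint_def scaled_lattice_iff)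
  then show ?thesis
    \<comment> \<open>The factors \<open>(1 / \<epsilon>)\<^sup>2\<close> and
      \<open>\<epsilon> ^ CARD('d)\<close> are common to numerator and denominator and
      cancel.\<close>
    using \<epsilon> by (simp add: sint_eq_image sum.reindex[OF inj] * sum_distrib_left[symmetric])
qed

lemma lambda_eps_eq_rayleigh_inf: "lambda_eps R K \<Omega> \<epsilon> = rayleigh_inf R K scaled_lint"
  unfolding lambda_eps_def rayleigh_inf_def
proof (rule INF_eq)
  fix y assume "y \<in> {y \<in> admissible R \<epsilon> \<Omega>. \<exists>x \<in> \<Omega> \<inter> scaled_lattice \<epsilon>. y x \<noteq> 0}"
  then obtain x where y: "y \<in> admissible R \<epsilon> \<Omega>" and x: "x \<in> \<Omega>" "x \<in> scaled_lattice \<epsilon>" "y x \<noteq> 0"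
    by auto
  obtain z where z: "z \<in> int_lattice" "x = \<epsilon> *\<^sub>R z"
    using x(2) by (rule mem_scaled_lattice_obtain)
  \<comment> \<open>Testing membership in \<Omega> suffices, because \<open>lattice_supp\<close>
    looks at lattice points only.\<close>
  define u where "u z = (if \<epsilon> *\<^sub>R z \<in> \<Omega> then y (\<epsilon> *\<^sub>R z) else 0)" for z
  have "lattice_supp u \<subseteq> scaled_lint"
    using y by (auto simp: lattice_supp_def u_def scaled_lint_def admissible_iff scaled_lattice_iff
        split: if_splits)
  moreover have "z \<in> lattice_supp u"
    using x z by (simp add: lattice_supp_def u_def)
  ultimately show "\<exists>u\<in>competitors scaled_lint. ereal (rayleigh R K u) \<le>
    ereal ((\<epsilon> ^ CARD('d) * (\<Sum>x \<in> sint R \<epsilon> \<Omega>. tensor_form R K (diff_quot \<epsilon> y x) (diff_quot \<epsilon> y x)))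
           / (\<epsilon> ^ CARD('d) * (\<Sum>x \<in> sint R \<epsilon> \<Omega>. matrix_norm_sq R (diff_quot \<epsilon> y x))))"
    using lambda_quotient_eq_rayleigh[of u y K]
    by (intro bexI[of _ u]) (auto simp: competitors_def u_def)
next
  fix u :: "real ^ 'd \<Rightarrow> real ^ 'd" assume u: "u \<in> competitors scaled_lint"
  define y where "y = restrict (\<lambda>x. u ((1 / \<epsilon>) *\<^sub>R x)) (\<Omega> \<inter> scaled_lattice \<epsilon>)"
  have supp: "lattice_supp u \<subseteq> scaled_lint" using u by (simp add: competitors_def)
  have uy: "u z = y (\<epsilon> *\<^sub>R z)" if "z \<in> int_lattice" "\<epsilon> *\<^sub>R z \<in> \<Omega>" for z
    using that \<epsilon> by (simp add: y_def scaled_lattice_iff)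
  have y: "y \<in> admissible R \<epsilon> \<Omega>"
    unfolding admissible_iff
  proof (intro conjI ballI impI)
    show "y \<in> \<Omega> \<inter> scaled_lattice \<epsilon> \<rightarrow>\<^sub>E UNIV" by (auto simp: y_def)
    fix x assume x: "x \<in> \<Omega> \<inter> scaled_lattice \<epsilon>" "y x \<noteq> 0"
    then obtain z where z: "z \<in> int_lattice" "x = \<epsilon> *\<^sub>R z"
      using mem_scaled_lattice_obtain by auto
    then have "z \<in> lattice_supp u" using x uy[of z] by (simp add: lattice_supp_def)
    then show "x \<in> lint R \<epsilon> \<Omega>" using supp z by (auto simp: scaled_lint_def)
  qed
  obtain z where z: "z \<in> lattice_supp u" using u by (auto simp: competitors_def)
  then have "\<epsilon> *\<^sub>R z \<in> \<Omega> \<inter> scaled_lattice \<epsilon>"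
    using supp by (auto simp: scaled_lint_def lint_def)
  moreover from this have "y (\<epsilon> *\<^sub>R z) \<noteq> 0"
    using z uy[of z] by (simp add: lattice_supp_def)
  ultimately show "\<exists>y\<in>{y \<in> admissible R \<epsilon> \<Omega>. \<exists>x \<in> \<Omega> \<inter> scaled_lattice \<epsilon>. y x \<noteq> 0}.
    ereal ((\<epsilon> ^ CARD('d) * (\<Sum>x \<in> sint R \<epsilon> \<Omega>. tensor_form R K (diff_quot \<epsilon> y x) (diff_quot \<epsilon> y x)))
           / (\<epsilon> ^ CARD('d) * (\<Sum>x \<in> sint R \<epsilon> \<Omega>. matrix_norm_sq R (diff_quot \<epsilon> y x))))
      \<le> ereal (rayleigh R K u)"
    using lambda_quotient_eq_rayleigh[of u y K, OF uy supp] y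
    by (intro bexI[of _ y]) auto
qed

lemma global_inf_le_lambda_eps: "global_inf R K \<le> lambda_eps R K \<Omega> \<epsilon>"
  unfolding lambda_eps_eq_rayleigh_inf using bounded_scaled_lint by (rule global_inf_le)

text \<open>Once \<epsilon> is small, the scaled support fits around the centre of a ball in
  \<Omega>. In \<open>small\<close>, \<open>M\<close> is the radius of the support,
  \<open>CARD('d)\<close> the error of rounding the centre to the lattice, and
  \<open>2 * R0 R\<close> the boundary layer.\<close>

lemma lambda_eps_le_rayleigh:
  assumes "\<Omega> \<noteq> {}" and ball: "ball x0 r \<subseteq> \<Omega>"
    and supp: "lattice_supp u \<noteq> {}" "\<And>z. z \<in> lattice_supp u \<Longrightarrow> norm z \<le> M"
    and small: "\<epsilon> * (M + real CARD('d) + 2 * R0 R) < r"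
  shows "lambda_eps R K \<Omega> \<epsilon> \<le> ereal (rayleigh R K u)"
  unfolding lambda_eps_eq_rayleigh_inf
proof (rule rayleigh_inf_le[OF supp(1)])
  \<comment> \<open>The rescaled centre rounded down to the lattice. Each coordinate errs by at most
    1, so the l1 bound on the norm gives \<open>CARD('d)\<close>.\<close>
  define a :: "real ^ 'd" where "a = (\<chi> i. of_int \<lfloor>x0 $ i / \<epsilon>\<rfloor>)"
  show a: "a \<in> int_lattice" by (simp add: a_def int_lattice_def)
  have "norm (a - (1 / \<epsilon>) *\<^sub>R x0) \<le> (\<Sum>i\<in>UNIV. \<bar>(a - (1 / \<epsilon>) *\<^sub>R x0) $ i\<bar>)"
    by (rule norm_le_l1_cart)
  also have "\<dots> \<le> (\<Sum>i\<in>(UNIV :: 'd set). 1)"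
  proof (rule sum_mono)
    fix i show "\<bar>(a - (1 / \<epsilon>) *\<^sub>R x0) $ i\<bar> \<le> 1"
      by (simp add: a_def) linarith
  qed
  finally have a_near: "norm (a - (1 / \<epsilon>) *\<^sub>R x0) \<le> real CARD('d)" by simp
  fix z assume z: "z \<in> lattice_supp u"
  let ?p = "\<epsilon> *\<^sub>R (z + a)"
  have "?p - x0 = \<epsilon> *\<^sub>R (z + (a - (1 / \<epsilon>) *\<^sub>R x0))"
    using \<epsilon> by (simp add: algebra_simps)
  then have "dist x0 ?p = \<epsilon> * norm (z + (a - (1 / \<epsilon>) *\<^sub>R x0))"
    using \<epsilon> by (simp only: dist_norm norm_minus_commute[of x0] norm_scaleR abs_of_pos)
  also have "\<dots> \<le> \<epsilon> * (M + real CARD('d))"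
    using \<epsilon> supp(2)[OF z] a_near
    by (intro mult_left_mono norm_triangle_le add_mono) auto
  finally have d: "dist x0 ?p + 2 * \<epsilon> * R0 R < r"
    using small by (simp add: algebra_simps)
  have "0 < \<epsilon> * R0 R" using \<epsilon> R0_pos by simp
  then have "?p \<in> \<Omega>" using d ball by auto
  moreover have "?p \<in> scaled_lattice \<epsilon>"
    using z a by (simp add: scaled_lattice_iff lattice_supp_def int_lattice_add)
  moreover have "2 * \<epsilon> * R0 R < infdist ?p (frontier \<Omega>)"
  proof -
    \<comment> \<open>\<open>infdist\<close> to the empty set is 0 by convention, so a positive
      lower bound needs boundary points; a nonempty bounded set has them, not being the whole
      space.\<close>
    have ne: "frontier \<Omega> \<noteq> {}"
      using assms(1) \<Omega>(2) not_bounded_UNIV frontier_not_empty by metis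
    have "r - dist x0 ?p \<le> dist ?p q" if "q \<in> frontier \<Omega>" for q
    proof -
      have "q \<notin> \<Omega>" using that \<Omega>(1) by (simp add: frontier_def interior_open)
      then have "r \<le> dist x0 q" using ball by (auto simp: subset_iff not_less)
      then show ?thesis using dist_triangle[of x0 q ?p] by simp
    qed
    then have "r - dist x0 ?p \<le> infdist ?p (frontier \<Omega>)"
      using ne by (simp add: infdist_def cINF_greatest)
    then show ?thesis using d by simp
  qed
  ultimately show "z + a \<in> scaled_lint" by (simp add: scaled_lint_def lint_def)
qed

end

section \<open>Passage to the limit in \<epsilon>\<close>

text \<open>The threshold for \<epsilon> depends on \<open>u\<close> through the radius
  \<open>M\<close> of its support. An upper bound for each \<open>u\<close> separately is enough to
  control an infimum over all \<open>u\<close>.\<close>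

lemma eventually_lambda_eps_le:
  assumes "open \<Omega>" "bounded \<Omega>" "\<Omega> \<noteq> {}" and "u \<in> finite_competitors"
  shows "\<forall>\<^sub>F \<epsilon> in at_right 0. lambda_eps R K \<Omega> \<epsilon> \<le> ereal (rayleigh R K u)"
proof -
  obtain x0 r where r: "r > 0" "ball x0 r \<subseteq> \<Omega>"
    using assms(1,3) open_contains_ball by blast
  have "lattice_supp u \<noteq> {}" and "bounded (lattice_supp u)"
    using assms(4) by (auto simp: finite_competitors_def finite_imp_bounded)
  then obtain M where M: "\<And>z. z \<in> lattice_supp u \<Longrightarrow> norm z \<le> M"
    by (auto simp: bounded_iff)
  have "((\<lambda>\<epsilon>. \<epsilon> * (M + real CARD('d) + 2 * R0 R)) \<longlongrightarrow> 0 * (M + real CARD('d) + 2 * R0 R)) (at_right 0)"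
    by (intro tendsto_intros)
  then have "\<forall>\<^sub>F \<epsilon> in at_right 0. \<epsilon> * (M + real CARD('d) + 2 * R0 R) < r"
    using r(1) by (intro order_tendstoD(2)) auto
  then show ?thesis
    using eventually_at_right_less[of "0 :: real"]
  proof eventually_elim
    case (elim \<epsilon>)
    then show ?case
      using lambda_eps_le_rayleigh[of \<Omega> \<epsilon> x0 r u M K] assms(1-3) r(2) M \<open>lattice_supp u \<noteq> {}\<close>
      by blast
  qed
qed

end

theorem proposition3p2:
  fixes R :: "(real ^ 'd) set"
    and K :: "'d \<Rightarrow> real ^ 'd \<Rightarrow> 'd \<Rightarrow> real ^ 'd \<Rightarrow> real"
    and \<Omega> :: "(real ^ 'd) set"
  assumes "interaction_range R"
    and "open \<Omega>" and "bounded \<Omega>" and "\<Omega> \<noteq> {}"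
  shows "((\<lambda>\<epsilon>. lambda_eps R K \<Omega> \<epsilon>) \<longlongrightarrow> lambda_atom R K \<Omega>) (at_right 0)
       \<and> lambda_atom R K \<Omega> = mu0 R K"
proof -
  note lower = global_inf_le_lambda_eps[OF assms(1-3)]
  note upper = eventually_lambda_eps_le[OF assms]
  have atom: "lambda_atom R K \<Omega> = global_inf R K"
  proof (rule antisym)
    show "global_inf R K \<le> lambda_atom R K \<Omega>"
      unfolding lambda_atom_def using lower by (intro INF_greatest) auto
    show "lambda_atom R K \<Omega> \<le> global_inf R K"
      unfolding global_inf_def
    proof (rule INF_greatest)
      fix u :: "real ^ 'd \<Rightarrow> real ^ 'd" assume "u \<in> finite_competitors"
      \<comment> \<open>The filter is nontrivial, so some positive \<epsilon> realises the bound;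
        positivity puts it into the index set of \<open>lambda_atom\<close>.\<close>
      then have "\<forall>\<^sub>F \<epsilon> in at_right 0. lambda_eps R K \<Omega> \<epsilon> \<le> ereal (rayleigh R K u) \<and> 0 < \<epsilon>"
        using upper eventually_at_right_less eventually_conj by blast
      then obtain \<epsilon> :: real where "lambda_eps R K \<Omega> \<epsilon> \<le> ereal (rayleigh R K u)" "0 < \<epsilon>"
        using eventually_happens trivial_limit_at_right_real by blast
      then show "lambda_atom R K \<Omega> \<le> ereal (rayleigh R K u)"
        unfolding lambda_atom_def by (intro INF_lower2[of \<epsilon>]) auto
    qed
  qed
  have "((\<lambda>\<epsilon>. lambda_eps R K \<Omega> \<epsilon>) \<longlongrightarrow> global_inf R K) (at_right 0)"
  \<comment> \<open>Convergence is checked in the order topology of \<open>ereal\<close>, so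
    infinite values need no case distinction. Below the limit, the lower bound holds at every
    positive \<epsilon>; above it, a single \<open>u\<close> with quotient less than
    \<open>c\<close> serves for all small \<epsilon>.\<close>
  proof (rule order_tendstoI)
    fix c assume "c < global_inf R K"
    then show "\<forall>\<^sub>F \<epsilon> in at_right 0. c < lambda_eps R K \<Omega> \<epsilon>"
      using eventually_at_right_less[of "0 :: real"] lower
      by (elim eventually_mono) (blast intro: less_le_trans)
  next
    fix c assume "global_inf R K < c"
    then obtain u :: "real ^ 'd \<Rightarrow> real ^ 'd"
      where u: "u \<in> finite_competitors" "ereal (rayleigh R K u) < c"
      by (auto simp: global_inf_def INF_less_iff)
    show "\<forall>\<^sub>F \<epsilon> in at_right 0. lambda_eps R K \<Omega> \<epsilon> < c"
      using upper[OF u(1), of K] by (rule eventually_mono) (use u(2) in \<open>blast intro: le_less_trans\<close>)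
  qed
  then show ?thesis
    using atom mu0_eq_global_inf[OF assms(1)] by simp
qed

end
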